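(* Let $a,b\in\mathbb{R}$ with $a\neq0$, $b>0$, and let $z_1=a+ib$, $z_2=-a+ib$. Let $W_{\Theta_\Delta}(z)$ and $V_{\Theta_\Delta}(z)$ be the transfer function and the impedance function of the interpolation L-system $\Theta_\Delta$ with the two nodes $z_1,z_2$. Then $$W_{\Theta_\Delta}(z)=\frac{(z-\bar z_1)(z+z_1)}{(z-z_1)(z+\bar z_1)},\qquad V_{\Theta_\Delta}(z)=\frac{Az}{B^2-z^2},$$ where $A=2b$ and $B=\sqrt{a^2+b^2}$. In particular, $V_{\Theta_\Delta}(z_k)=i$ for $k=1,2$, and $V_{\Theta_\Delta}$ is a rational Herglotz-Nevanlinna function.
   Context: A scalar (canonical) L-system is an array $\Theta=\begin{pmatrix}T&K&1\\ \mathcal{H}&&\mathbb{C}\end{pmatrix}$, where $\mathcal{H}$ is a Hilbert space, $T$ is a bounded operator on $\mathcal{H}$, and $K:\mathbb{C}\to\mathcal{H}$ is linear with $\operatorname{Im}T:=\frac1{2i}(T-T^* )=KK^*$. Its transfer function is $W_\Theta(z)=1-2iK^*(T-zI)^{-1}K$ for $z\in\rho(T)$, and its impedance function is $V_\Theta(z)=K^*(\operatorname{Re}T-zI)^{-1}K$ for $z\in\rho(\operatorname{Re}T)$, where $\operatorname{Re}T=\frac12(T+T^* )$; they are related by the Cayley transform $V_\Theta=i\frac{W_\Theta-1}{W_\Theta+1}$, $W_\Theta=\frac{1-iV_\Theta}{1+iV_\Theta}$ (for $\operatorname{Im}z\ne0$, $z\in\rho(T)$). For $z_1,\dots,z_m$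 in the open upper half-plane $\mathbb{C}_+$ the interpolation L-system is $\Theta_\Delta=\begin{pmatrix}T_\Delta&K_\Delta&1\\ \mathbb{C}^m&&\mathbb{C}\end{pmatrix}$, where $T_\Delta$ is the upper triangular $m\times m$ matrix with diagonal entries $z_1,\dots,z_m$ and $(j,k)$ entry $2i\sqrt{\operatorname{Im}z_j\cdot\operatorname{Im}z_k}$ for $j<k$ (zero for $j>k$), and $K_\Delta c=c\,g_\Delta$ with $g_\Delta=(\sqrt{\operatorname{Im}z_1},\dots,\sqrt{\operatorname{Im}z_m})^T$. Its transfer function is $W_{\Theta_\Delta}(z)=\prod_{k=1}^m\frac{z-\bar z_k}{z-z_k}$ (a known fact). A Herglotz-Nevanlinna function is one that is analytic on $\mathbb{C}_+$ with nonnegative imaginary part there. *)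

theory Defs
  imports
    "HOL-Analysis.Complex_Analysis_Basics"
    "HOL-Computational_Algebra.Polynomial"
    "Jordan_Normal_Form.Gauss_Jordan_Elimination"
    "Jordan_Normal_Form.Schur_Decomposition"
begin

text \<open>
  Scalar L-systems with state space \<open>\<complex>\<^sup>m\<close>. The linear map \<open>K : \<complex> \<Rightarrow> \<complex>\<^sup>m\<close> is represented by
  its \<open>m \<times> 1\<close> matrix (the column \<open>K 1\<close>), so that \<open>K\<^sup>*\<close> is a \<open>1 \<times> m\<close> matrix.
\<close>

record l_system =
  state_op :: "complex mat"
  channel_op :: "complex mat"

definition mat_Re :: "complex mat \<Rightarrow> complex mat" where
  "mat_Re T = (1 / 2) \<cdot>\<^sub>m (T + mat_adjoint T)"

definition mat_Im :: "complex mat \<Rightarrow> complex mat" where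
  "mat_Im T = (1 / (2 * \<i>)) \<cdot>\<^sub>m (T - mat_adjoint T)"

definition is_l_system :: "nat \<Rightarrow> l_system \<Rightarrow> bool" where
  "is_l_system m \<Theta> \<longleftrightarrow>
     state_op \<Theta> \<in> carrier_mat m m \<and> channel_op \<Theta> \<in> carrier_mat m 1 \<and>
     mat_Im (state_op \<Theta>) = channel_op \<Theta> * mat_adjoint (channel_op \<Theta>)"

definition shifted :: "complex mat \<Rightarrow> complex \<Rightarrow> complex mat" where
  "shifted T z = T - z \<cdot>\<^sub>m 1\<^sub>m (dim_row T)"

definition resolvent_set :: "complex mat \<Rightarrow> complex set" where
  "resolvent_set T = {z. invertible_mat (shifted T z)}"

text \<open>The following are meaningful only for \<open>z \<in> resolvent_set T\<close>
  (respectively for \<open>z\<close> in the resolvent set of \<open>T\<close> or of its real part).\<close>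

definition resolvent :: "complex mat \<Rightarrow> complex \<Rightarrow> complex mat" where
  "resolvent T z = the (mat_inverse (shifted T z))"

definition transfer_function :: "l_system \<Rightarrow> complex \<Rightarrow> complex" where
  "transfer_function \<Theta> z =
     1 - 2 * \<i> *
       (mat_adjoint (channel_op \<Theta>) * resolvent (state_op \<Theta>) z * channel_op \<Theta>) $$ (0, 0)"

definition impedance_function :: "l_system \<Rightarrow> complex \<Rightarrow> complex" where
  "impedance_function \<Theta> z =
     (mat_adjoint (channel_op \<Theta>) * resolvent (mat_Re (state_op \<Theta>)) z * channel_op \<Theta>) $$ (0, 0)"

text \<open>Indices start at 0 here: node number \<open>j + 1\<close> is \<open>zs ! j\<close>.\<close>

definition interpolation_system :: "complex list \<Rightarrow> l_system" where
  "interpolation_system zs =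
     \<lparr> state_op = Matrix.mat (length zs) (length zs) (\<lambda>(j, k).
          if j = k then zs ! j
          else if j < k then 2 * \<i> * complex_of_real (sqrt (Im (zs ! j) * Im (zs ! k)))
          else 0),
       channel_op = Matrix.mat (length zs) 1 (\<lambda>(j, _). complex_of_real (sqrt (Im (zs ! j)))) \<rparr>"

definition herglotz_nevanlinna :: "(complex \<Rightarrow> complex) \<Rightarrow> bool" where
  "herglotz_nevanlinna f \<longleftrightarrow>
     f analytic_on {z. Im z > 0} \<and> (\<forall>z. Im z > 0 \<longrightarrow> Im (f z) \<ge> 0)"

definition rational_on :: "complex set \<Rightarrow> (complex \<Rightarrow> complex) \<Rightarrow> bool" where
  "rational_on D f \<longleftrightarrow>
     (\<exists>p q :: complex poly. \<forall>z\<in>D. poly q z \<noteq> 0 \<and> f z = poly p z / poly q z)"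

lemma mat_adjoint_index:
  assumes "i < dim_col A" "j < dim_row A"
  shows "mat_adjoint A $$ (i, j) = conjugate (A $$ (j, i))"
  using assms by (simp add: mat_adjoint_def mat_of_rows_def)

lemma mat_adjoint_dims [simp]:
  "dim_row (mat_adjoint A) = dim_col A" "dim_col (mat_adjoint A) = dim_row A"
  by (simp_all add: mat_adjoint_def)

lemma is_l_system_interpolation_system:
  assumes "\<forall>z\<in>set zs. Im z > 0"
  shows "is_l_system (length zs) (interpolation_system zs)"
proof -
  have pos: "Im (zs ! j) > 0" if "j < length zs" for j
    using assms that by simp
  show ?thesis
    unfolding is_l_system_def
  proof (intro conjI)
    show "mat_Im (state_op (interpolation_system zs)) =
        channel_op (interpolation_system zs) * mat_adjoint (channel_op (interpolation_system zs))"
      by (rule eq_matI)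
        (auto simp: mat_Im_def interpolation_system_def mat_adjoint_index scalar_prod_def
          real_sqrt_mult complex_eq_iff pos less_imp_le Re_divide Im_divide)
  qed (simp_all add: interpolation_system_def)
qed

end

theory Submission
  imports Defs
begin

text \<open>
  The state space is \<open>\<complex>\<^sup>2\<close>, so both resolvents are explicit by the adjugate formula
  (\<open>mat_inverse_2\<close>). Sandwiching the inverse between \<open>K\<^sup>*\<close> and \<open>K\<close>
  (\<open>resolvent_form_2\<close>) yields a quotient whose denominator is the characteristic determinant,
  and whose zeros are exactly the points outside the resolvent set.

  For \<open>T\<close>, which is triangular, the determinant is \<open>(z1 - z) * (z2 - z)\<close>. The symmetry of the
  nodes, \<open>z2 = - cnj z1\<close>, turns it into \<open>(z - z1) * (z + cnj z1)\<close>, and \<open>2 * \<i> * b = z1 - cnj z1\<close>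
  does the rest. The real part of \<open>T\<close> has diagonal \<open>a, - a\<close> and off-diagonal entries
  \<open>\<i> * b, - \<i> * b\<close>: the diagonal cancels in the trace and the off-diagonal entries cancel in the
  numerator, which leaves \<open>- 2 * b * z\<close> over \<open>z\<^sup>2 - B\<^sup>2\<close>.

  The real part of \<open>T\<close> is Hermitian, and its two eigenvalues \<open>B\<close> and \<open>- B\<close> are real, so the upper
  half-plane lies in its resolvent set. The Herglotz-Nevanlinna property is visible in
  partial fractions: \<open>V z = b * (1 / (B - z) + 1 / (- B - z))\<close>, and each summand maps the upper
  half-plane into itself.
\<close>

text \<open>Matrix entries are addressed by the literals 0 and 1 below; rewriting 1 to \<open>Suc 0\<close> would
  keep the entry lemmas from matching.\<close>

declare One_nat_def [simp del]

lemma eq_mat_2I: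
  assumes "A \<in> carrier_mat 2 2" "B \<in> carrier_mat 2 2"
    and "A $$ (0,0) = B $$ (0,0)" "A $$ (0,1) = B $$ (0,1)"
    and "A $$ (1,0) = B $$ (1,0)" "A $$ (1,1) = B $$ (1,1)"
  shows "A = B"
proof (rule eq_matI)
  fix i j assume "i < dim_row B" "j < dim_col B"
  then have "i \<in> {0, 1}" "j \<in> {0, 1}" using assms(2) by auto
  then show "A $$ (i, j) = B $$ (i, j)" using assms by auto
qed (use assms in auto)

lemma index_mult_mat_inner_2:
  assumes "A \<in> carrier_mat m 2" "B \<in> carrier_mat 2 n" "i < m" "j < n"
  shows "(A * B) $$ (i, j) = A $$ (i, 0) * B $$ (0, j) + A $$ (i, 1) * B $$ (1, j)"
  using assms by (simp add: scalar_prod_def sum.atLeast_Suc_lessThan numeral_2_eq_2 One_nat_def)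

definition adjugate_2 :: "'a::comm_ring_1 mat \<Rightarrow> 'a mat" where
  "adjugate_2 M = Matrix.mat 2 2 (\<lambda>(i, j).
     if i = j then M $$ (1 - i, 1 - i) else - M $$ (i, j))"

definition det_2 :: "'a::comm_ring_1 mat \<Rightarrow> 'a" where
  "det_2 M = M $$ (0,0) * M $$ (1,1) - M $$ (0,1) * M $$ (1,0)"

lemma adjugate_2_carrier [simp]: "adjugate_2 M \<in> carrier_mat 2 2"
  by (simp add: adjugate_2_def)

lemma adjugate_2_index:
  "adjugate_2 M $$ (0,0) = M $$ (1,1)" "adjugate_2 M $$ (0,1) = - M $$ (0,1)"
  "adjugate_2 M $$ (1,0) = - M $$ (1,0)" "adjugate_2 M $$ (1,1) = M $$ (0,0)"
  by (simp_all add: adjugate_2_def)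

lemma adjugate_2_inverse:
  fixes M :: "'a::field mat"
  assumes M: "M \<in> carrier_mat 2 2" and d: "det_2 M \<noteq> 0"
  defines "N \<equiv> (1 / det_2 M) \<cdot>\<^sub>m adjugate_2 M"
  shows "N \<in> carrier_mat 2 2" "M * N = 1\<^sub>m 2" "N * M = 1\<^sub>m 2"
proof -
  show N: "N \<in> carrier_mat 2 2" by (simp add: N_def)
  have N_index: "N $$ (i, j) = adjugate_2 M $$ (i, j) / det_2 M" if "i < 2" "j < 2" for i j
    using that carrier_matD[OF adjugate_2_carrier[of M]] by (simp add: N_def)
  have entries: "M $$ (0,0) * M $$ (1,1) / det_2 M - M $$ (0,1) * M $$ (1,0) / det_2 M = 1"
    using d by (simp add: det_2_def flip: diff_divide_distrib)
  show "M * N = 1\<^sub>m 2"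
    using entries by (intro eq_mat_2I mult_carrier_mat[OF M N] one_carrier_mat)
      (simp_all add: index_mult_mat_inner_2[OF M N] N_index adjugate_2_index mult.commute
        del: index_mult_mat(1))
  show "N * M = 1\<^sub>m 2"
    using entries by (intro eq_mat_2I mult_carrier_mat[OF N M] one_carrier_mat)
      (simp_all add: index_mult_mat_inner_2[OF N M] N_index adjugate_2_index mult.commute
        del: index_mult_mat(1))
qed

lemma det_2_mult:
  fixes M N :: "'a::comm_ring_1 mat"
  assumes "M \<in> carrier_mat 2 2" "N \<in> carrier_mat 2 2"
  shows "det_2 (M * N) = det_2 M * det_2 N"
  using assms unfolding det_2_def
  by (simp add: index_mult_mat_inner_2[of _ 2 _ 2] algebra_simps del: index_mult_mat(1))

text \<open>One direction is multiplicativity of the determinant, the other is the adjugate inverse. In the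
  first, the witness of invertibility comes without dimensions; they are read off from the two
  products.\<close>

lemma invertible_mat_2_iff:
  fixes M :: "'a::field mat"
  assumes M: "M \<in> carrier_mat 2 2"
  shows "invertible_mat M \<longleftrightarrow> det_2 M \<noteq> 0"
proof
  assume "invertible_mat M"
  then obtain N where N: "M * N = 1\<^sub>m (dim_row M)" "N * M = 1\<^sub>m (dim_row N)"
    by (auto simp: invertible_mat_def inverts_mat_def)
  have "dim_col N = 2" "dim_row N = 2"
    using N M by (metis carrier_matD index_mult_mat(3) index_one_mat(3))+
  then have "N \<in> carrier_mat 2 2" by auto
  then have "det_2 M * det_2 N = det_2 (1\<^sub>m 2)"
    using det_2_mult[OF M, of N] N(1) M by auto
  then show "det_2 M \<noteq> 0" by (auto simp: det_2_def)
next
  assume "det_2 M \<noteq> 0"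
  then show "invertible_mat M"
    using M adjugate_2_inverse[OF M] unfolding invertible_mat_def inverts_mat_def
    by (metis carrier_matD square_mat.simps)
qed

text \<open>\<^const>\<open>mat_inverse\<close> is specified only as returning some two-sided inverse, so its value
  is identified through uniqueness of inverses.\<close>

lemma mat_inverse_2:
  fixes M :: "'a::field mat"
  assumes M: "M \<in> carrier_mat 2 2" and "invertible_mat M"
  shows "mat_inverse M = Some ((1 / det_2 M) \<cdot>\<^sub>m adjugate_2 M)"
proof -
  let ?N = "(1 / det_2 M) \<cdot>\<^sub>m adjugate_2 M"
  have d: "det_2 M \<noteq> 0" using assms invertible_mat_2_iff by blast
  note N = adjugate_2_inverse(1)[OF M d] and inv = adjugate_2_inverse(2,3)[OF M d]
  show ?thesis
  proof (cases "mat_inverse M")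
    case None
    then have "M \<notin> Units (ring_mat TYPE('a) 2 ())" by (rule mat_inverse(1)[OF M])
    then show ?thesis using M N inv by (auto simp: Units_def ring_mat_def)
  next
    case (Some B)
    then have B: "B * M = 1\<^sub>m 2" "B \<in> carrier_mat 2 2" using mat_inverse(2)[OF M] by auto
    have "B = B * (M * ?N)" using B inv by simp
    also have "\<dots> = (B * M) * ?N" using assoc_mult_mat[OF B(2) M N] by simp
    also have "\<dots> = ?N" unfolding B(1) by (rule left_mult_one_mat[OF N])
    finally show ?thesis using Some by simp
  qed
qed

lemma shifted_2:
  assumes "T \<in> carrier_mat 2 2"
  shows "shifted T z \<in> carrier_mat 2 2"
    "shifted T z $$ (0,0) = T $$ (0,0) - z" "shifted T z $$ (0,1) = T $$ (0,1)"
    "shifted T z $$ (1,0) = T $$ (1,0)" "shifted T z $$ (1,1) = T $$ (1,1) - z"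
  using assms by (auto simp: shifted_def)

lemma resolvent_set_2_iff:
  assumes "T \<in> carrier_mat 2 2"
  shows "z \<in> resolvent_set T \<longleftrightarrow>
    (T $$ (0,0) - z) * (T $$ (1,1) - z) - T $$ (0,1) * T $$ (1,0) \<noteq> 0"
  using invertible_mat_2_iff[OF shifted_2(1)[OF assms]] shifted_2[OF assms]
  by (simp add: resolvent_set_def det_2_def)

text \<open>The common shape of the transfer and the impedance function of a system on \<open>\<complex>\<^sup>2\<close>: the
  first uses \<open>T\<close> itself, the second its real part. The off-diagonal entries enter only through
  their sum because \<open>K\<close> is real, which is what makes them cancel in the impedance function.\<close>

lemma resolvent_form_2:
  assumes T: "T \<in> carrier_mat 2 2" and K: "K \<in> carrier_mat 2 1"
    and z: "z \<in> resolvent_set T"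
    and k: "K $$ (0,0) = of_real k" "K $$ (1,0) = of_real l"
  shows "(mat_adjoint K * resolvent T z * K) $$ (0,0) =
    (k\<^sup>2 * (T $$ (1,1) - z) - k * l * (T $$ (0,1) + T $$ (1,0)) + l\<^sup>2 * (T $$ (0,0) - z)) /
    ((T $$ (0,0) - z) * (T $$ (1,1) - z) - T $$ (0,1) * T $$ (1,0))"
proof -
  let ?M = "shifted T z"
  have M: "?M \<in> carrier_mat 2 2" using shifted_2[OF T] by simp
  have R: "resolvent T z = (1 / det_2 ?M) \<cdot>\<^sub>m adjugate_2 ?M"
    using mat_inverse_2[OF M] z by (simp add: resolvent_def resolvent_set_def)
  have Rc: "resolvent T z \<in> carrier_mat 2 2" by (simp add: R)
  have Kc: "mat_adjoint K \<in> carrier_mat 1 2"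
    using K by (intro carrier_matI) simp_all
  have Ki: "mat_adjoint K $$ (0,0) = of_real k" "mat_adjoint K $$ (0,1) = of_real l"
    using K k by (auto simp: mat_adjoint_index)
  have Ri: "resolvent T z $$ (i, j) = adjugate_2 ?M $$ (i, j) / det_2 ?M"
    if "i < 2" "j < 2" for i j
    using that carrier_matD[OF adjugate_2_carrier[of ?M]] by (simp add: R)
  have d: "det_2 ?M = (T $$ (0,0) - z) * (T $$ (1,1) - z) - T $$ (0,1) * T $$ (1,0)"
    using shifted_2[OF T] by (simp add: det_2_def)
  have "(mat_adjoint K * resolvent T z * K) $$ (0,0) =
    (k * resolvent T z $$ (0,0) + l * resolvent T z $$ (1,0)) * k +
    (k * resolvent T z $$ (0,1) + l * resolvent T z $$ (1,1)) * l"
    by (simp add: index_mult_mat_inner_2[OF mult_carrier_mat[OF Kc Rc] K]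
        index_mult_mat_inner_2[OF Kc Rc] Ki k del: index_mult_mat(1))
  also have "\<dots> = (k\<^sup>2 * (T $$ (1,1) - z) - k * l * (T $$ (0,1) + T $$ (1,0)) +
      l\<^sup>2 * (T $$ (0,0) - z)) / det_2 ?M"
    unfolding add_divide_distrib diff_divide_distrib
    by (simp add: Ri adjugate_2_index shifted_2[OF T] power2_eq_square add_divide_distrib
        diff_divide_distrib distrib_left distrib_right right_diff_distrib left_diff_distrib ac_simps)
  finally show ?thesis by (simp add: d)
qed

lemma interpolation_system_2:
  fixes z1 z2 :: complex
  defines "S \<equiv> interpolation_system [z1, z2]"
  shows "state_op S \<in> carrier_mat 2 2" "channel_op S \<in> carrier_mat 2 1"
    "state_op S $$ (0,0) = z1" "state_op S $$ (1,1) = z2" "state_op S $$ (1,0) = 0"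
    "state_op S $$ (0,1) = 2 * \<i> * sqrt (Im z1 * Im z2)"
    "channel_op S $$ (0,0) = sqrt (Im z1)" "channel_op S $$ (1,0) = sqrt (Im z2)"
  by (auto simp: S_def interpolation_system_def)

lemma mat_Re_interpolation_system_2:
  fixes z1 z2 :: complex
  defines "R \<equiv> mat_Re (state_op (interpolation_system [z1, z2]))"
  shows "R \<in> carrier_mat 2 2"
    "R $$ (0,0) = Re z1" "R $$ (1,1) = Re z2"
    "R $$ (0,1) = \<i> * sqrt (Im z1 * Im z2)" "R $$ (1,0) = - \<i> * sqrt (Im z1 * Im z2)"
  by (auto simp: R_def mat_Re_def interpolation_system_def mat_adjoint_index complex_eq_iff)

text \<open>The building block of rational Herglotz-Nevanlinna functions: the imaginary part is
  \<open>Im z\<close> divided by the squared modulus of \<open>B - z\<close>.\<close>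

lemma Im_reciprocal_real_diff_nonneg:
  assumes "Im z \<ge> 0"
  shows "Im (1 / (of_real B - z)) \<ge> 0"
  using assms by (simp add: Im_divide)

lemma of_real_square_diff_eq_0_imp_real:
  fixes z :: complex and B :: real
  assumes "(of_real B)\<^sup>2 - z\<^sup>2 = 0"
  shows "Im z = 0"
proof -
  have "z = of_real B \<or> z = - of_real B"
    using assms by (metis eq_iff_diff_eq_0 power2_eq_iff)
  then show ?thesis by auto
qed

theorem lemma11:
  fixes a b A B :: real and z1 z2 :: complex and \<Theta> :: l_system
    and W V :: "complex \<Rightarrow> complex"
  assumes "a \<noteq> 0" and "b > 0"
    and "z1 = Complex a b" and "z2 = Complex (- a) b"
    and "\<Theta> = interpolation_system [z1, z2]"
    and "W = transfer_function \<Theta>" and "V = impedance_function \<Theta>"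
    and "A = 2 * b" and "B = sqrt (a\<^sup>2 + b\<^sup>2)"
  shows
    "(\<forall>z \<in> resolvent_set (state_op \<Theta>).
        W z = ((z - cnj z1) * (z + z1)) / ((z - z1) * (z + cnj z1))) \<and>
     (\<forall>z \<in> resolvent_set (mat_Re (state_op \<Theta>)).
        V z = of_real A * z / ((of_real B)\<^sup>2 - z\<^sup>2)) \<and>
     (\<forall>zk \<in> {z1, z2}. zk \<in> resolvent_set (mat_Re (state_op \<Theta>)) \<and> V zk = \<i>) \<and>
     rational_on (resolvent_set (mat_Re (state_op \<Theta>))) V \<and>
     {z. Im z > 0} \<subseteq> resolvent_set (mat_Re (state_op \<Theta>)) \<and>
     herglotz_nevanlinna V"
proof -
  let ?T = "state_op \<Theta>" and ?K = "channel_op \<Theta>"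
  let ?R = "mat_Re ?T" and ?f = "\<lambda>z. of_real A * z / ((of_real B)\<^sup>2 - z\<^sup>2)"
  have Im: "Im z1 = b" "Im z2 = b" and Re: "Re z1 = a" "Re z2 = - a"
    using assms by simp_all
  have z2: "z2 = - cnj z1" using assms by (simp add: complex_eq_iff)
  have b2: "sqrt (b * b) = b" using \<open>b > 0\<close> by simp_all
  have b_eq: "2 * \<i> * of_real b = z1 - cnj z1" using Im by (simp add: complex_eq_iff)
  have B2: "(of_real B :: complex)\<^sup>2 = (of_real a)\<^sup>2 + (of_real b)\<^sup>2"
    unfolding \<open>B = _\<close> by (simp flip: of_real_power of_real_add)
  note T = interpolation_system_2[of z1 z2, folded \<open>\<Theta> = _\<close>, unfolded Im Re b2]
  note R = mat_Re_interpolation_system_2[of z1 z2, folded \<open>\<Theta> = _\<close>, unfolded Im Re b2]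
  have b_sqrt: "(of_real (sqrt b))\<^sup>2 = (of_real b :: complex)"
    using \<open>b > 0\<close> by (simp flip: of_real_power)
  have form: "(mat_adjoint ?K * resolvent S z * ?K) $$ (0,0) =
      of_real b * (S $$ (0,0) + S $$ (1,1) - 2 * z - (S $$ (0,1) + S $$ (1,0))) /
      ((S $$ (0,0) - z) * (S $$ (1,1) - z) - S $$ (0,1) * S $$ (1,0))"
    if "S \<in> carrier_mat 2 2" "z \<in> resolvent_set S" for S z
    unfolding resolvent_form_2[OF that(1) T(2) that(2) T(7,8)] power2_eq_square[symmetric] b_sqrt
    by (simp add: algebra_simps)
  have resT: "z \<in> resolvent_set ?T \<longleftrightarrow> (z1 - z) * (z2 - z) \<noteq> 0" for z
    unfolding resolvent_set_2_iff[OF T(1)] T by simp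
  \<comment> \<open>The sign and the coercions are those produced by inserting the entries of the real part.\<close>
  have detR: "(of_real a - z) * (of_real (- a) - z) - \<i> * of_real b * (- \<i> * of_real b) =
      - ((of_real B)\<^sup>2 - z\<^sup>2)" for z
    unfolding B2 by (simp add: algebra_simps power2_eq_square)
  have resR: "z \<in> resolvent_set ?R \<longleftrightarrow> (of_real B)\<^sup>2 - z\<^sup>2 \<noteq> 0" for z
    unfolding resolvent_set_2_iff[OF R(1)] R detR neg_equal_0_iff_equal ..
  have W: "W z = ((z - cnj z1) * (z + z1)) / ((z - z1) * (z + cnj z1))"
    if z: "z \<in> resolvent_set ?T" for z
  proof -
    have nz: "z - z1 \<noteq> 0" "z + cnj z1 \<noteq> 0" using z unfolding resT z2
      by (auto simp: add_eq_0_iff)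
    have "W z = 1 - 2 * \<i> * of_real b * (z1 + z2 - 2 * z - 2 * \<i> * of_real b) / ((z1 - z) * (z2 - z))"
      unfolding \<open>W = _\<close> transfer_function_def form[OF T(1) z] T by simp
    also have "\<dots> = ((z - cnj z1) * (z + z1)) / ((z - z1) * (z + cnj z1))"
    proof -
      have one_minus: "1 - x / d = (d - x) / d" if "d \<noteq> 0" for x d :: complex
        using that by (simp add: diff_divide_distrib)
      have denom: "(z1 - z) * (z2 - z) = (z - z1) * (z + cnj z1)"
        unfolding z2 by (simp add: algebra_simps)
      have "(z - z1) * (z + cnj z1) - (z1 - cnj z1) * (z1 + - cnj z1 - 2 * z - (z1 - cnj z1)) =
          (z - cnj z1) * (z + z1)"
        by (simp add: algebra_simps)
      then show ?thesis
        \<comment> \<open>\<open>denom\<close> mentions \<open>z2\<close>, so it has to be applied before \<open>z2\<close> is eliminated.\<close>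
        unfolding denom unfolding b_eq z2
        by (subst one_minus) (use nz in \<open>simp_all only: mult_eq_0_iff de_Morgan_disj simp_thms\<close>)
    qed
    finally show ?thesis .
  qed
  have V: "V z = ?f z" if z: "z \<in> resolvent_set ?R" for z
  proof -
    have "V z = of_real b * (- 2 * z) / (- ((of_real B)\<^sup>2 - z\<^sup>2))"
      unfolding \<open>V = _\<close> impedance_function_def form[OF R(1) z] R detR by simp
    also have "\<dots> = ?f z" unfolding minus_divide_right[symmetric] \<open>A = _\<close> by simp
    finally show ?thesis .
  qed
  have upper: "z \<in> resolvent_set ?R" if "Im z > 0" for z
    using that of_real_square_diff_eq_0_imp_real[of B z] unfolding resR by auto
  have nodes: "V zk = \<i>" if "zk \<in> {z1, z2}" for zk
  proof -
    have "zk \<in> resolvent_set ?R" using that Im \<open>b > 0\<close> by (auto intro: upper)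
    \<comment> \<open>At both nodes \<open>B\<^sup>2 - zk\<^sup>2 = - 2 * \<i> * b * zk\<close>.\<close>
    moreover have "of_real A * zk = \<i> * ((of_real B)\<^sup>2 - zk\<^sup>2)"
      using that unfolding B2 \<open>A = _\<close>
      by (auto simp: complex_eq_iff assms(3,4) power2_eq_square algebra_simps)
    ultimately show ?thesis using V resR by simp
  qed
  have "rational_on (resolvent_set ?R) V"
    unfolding rational_on_def
    by (rule exI[of _ "[:0, of_real A:]"], rule exI[of _ "[:(of_real B)\<^sup>2, 0, -1:]"])
      (use V resR in \<open>simp add: power2_eq_square algebra_simps\<close>)
  moreover have "herglotz_nevanlinna V"
    unfolding herglotz_nevanlinna_def
  proof (intro conjI allI impI)
    have open_upper: "open {z. Im z > 0}" by (rule open_halfspace_Im_gt)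
    have "?f holomorphic_on {z. Im z > 0}"
      using upper resR by (auto intro!: holomorphic_intros)
    then have "V holomorphic_on {z. Im z > 0}"
      using V upper by (subst holomorphic_cong[OF refl, of _ _ ?f]) auto
    then show "V analytic_on {z. Im z > 0}" by (simp add: analytic_on_open open_upper)
  next
    fix z :: complex assume z: "Im z > 0"
    have nz: "of_real B - z \<noteq> 0" "of_real (- B) - z \<noteq> 0" using z by (auto simp: complex_eq_iff)
    have "of_real b * (1 / (of_real B - z) + 1 / (of_real (- B) - z)) =
        of_real b * (- 2 * z) / ((of_real B - z) * (of_real (- B) - z))"
      unfolding add_frac_eq[OF nz] by simp
    also have "(of_real B - z) * (of_real (- B) - z) = - ((of_real B)\<^sup>2 - z\<^sup>2)"
      by (simp add: power2_eq_square algebra_simps)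
    also have "of_real b * (- 2 * z) / (- ((of_real B)\<^sup>2 - z\<^sup>2)) = V z"
      unfolding V[OF upper[OF z]] minus_divide_right[symmetric] \<open>A = _\<close> by simp
    finally have "V z = of_real b * (1 / (of_real B - z) + 1 / (of_real (- B) - z))" ..
    then show "Im (V z) \<ge> 0"
      using Im_reciprocal_real_diff_nonneg[of z B] Im_reciprocal_real_diff_nonneg[of z "- B"]
        z \<open>b > 0\<close> by simp
  qed
  moreover have "zk \<in> resolvent_set ?R \<and> V zk = \<i>" if "zk \<in> {z1, z2}" for zk
    using that nodes upper[of zk] Im \<open>b > 0\<close> by auto
  ultimately show ?thesis using W V upper by blast
qed

end
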